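(* Let $H$ be a real Hilbert space with scalar product $(\cdot,\cdot)$ and norm $\|u\|=\sqrt{(u,u)}$. Let $A: H\to H$ be an odd compact potential operator, and assume that there exists $\theta\in[0,1)$ such that $$\limsup_{\|u\|\to+\infty}\frac{\|Au\|}{\|u\|^{\theta}}<\infty .$$ Assume further that there exists a linear self-adjoint operator $B_2$ on $H$ such that (i) there exist $e_2,e_3\in H$ with $\|e_2\|=\|e_3\|=1$ and $(e_2,e_3)=0$ satisfying $$\big(B_2(e_i),e_i\big)>1\quad (i=2,3)$$ and $$\big(B_2(e_2),e_3\big)^2-\Big(1-\big(B_2(e_2),e_2\big)\Big)\Big(1-\big(B_2(e_3),e_3\big)\Big)<0;$$ (ii) there exists a constant $r_2>0$ such that $$\big(A(su),u\big)\geq\big(B_2(su),u\big)$$ for all $s\in(0,1)$ and all $u$ in the linear span of $\{e_2,e_3\}$ with $\|u\|=r_2$. Then $A$ has two pairs of fixed points in $H\setminus\{0\}$; that is, there exist $u_1,u_2\in H\setminus\{0\}$ with $u_1\neq u_2$ and $u_1\neq -u_2$ such that $A(\pm u_1)=\pm u_1$ and $A(\pm u_2)=\pm u_2$.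
   Context: A mapping $A: H\to H$ (not necessarily linear) is called compact if it maps bounded sets onto relatively compact sets. It is odd if $A(-u)=-A(u)$ for all $u\in H$. It is a potential operator if there exists a Gâteaux differentiable functional $T: H\to\mathbb{R}$ such that $T'(u)=A(u)$ for every $u\in H$, where the dual of $H$ is identified with $H$ via the scalar product, i.e. the Gâteaux derivative of $T$ at $u$ in direction $v$ equals $(A(u),v)$ for all $u,v\in H$. A pair of fixed points means a set $\{u,-u\}$ with $u\neq 0$ both of whose elements are fixed points of $A$; two pairs means two distinct such sets.
   Formalization: "Compact" is taken to include continuity of A, in addition to mapping bounded sets onto relatively compact sets; without continuity the claim fails (a discontinuous odd potential operator on R² satisfying all hypotheses can have only one pair of nonzero fixed points). *)

theory Defs
  imports "HOL-Analysis.Analysis"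
begin

text \<open>
  A nonlinear operator is compact if it is continuous and maps bounded sets to relatively
  compact sets. Continuity is automatic only for linear operators and is usually understood
  for nonlinear ones; it is spelled out here because it does not follow from the second
  condition, even for gradients of differentiable functionals (already on the real line).
\<close>
definition compact_operator :: "('a::real_normed_vector \<Rightarrow> 'b::real_normed_vector) \<Rightarrow> bool"
  where "compact_operator A \<longleftrightarrow>
    continuous_on UNIV A \<and> (\<forall>S. bounded S \<longrightarrow> compact (closure (A ` S)))"

definition odd_operator :: "('a::real_vector \<Rightarrow> 'b::real_vector) \<Rightarrow> bool"
  where "odd_operator A \<longleftrightarrow> (\<forall>u. A (- u) = - A u)"

definition has_gateaux_derivative ::
    "('a::real_normed_vector \<Rightarrow> real) \<Rightarrow> ('a \<Rightarrow> real) \<Rightarrow> 'a \<Rightarrow> bool"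
  where "has_gateaux_derivative T L u \<longleftrightarrow>
    bounded_linear L \<and> (\<forall>v. ((\<lambda>t. T (u + t *\<^sub>R v)) has_real_derivative L v) (at 0))"

text \<open>The dual space is identified with the space itself via the inner product.\<close>
definition potential_operator :: "('a::real_inner \<Rightarrow> 'a) \<Rightarrow> bool"
  where "potential_operator A \<longleftrightarrow>
    (\<exists>T. \<forall>u. has_gateaux_derivative T (\<lambda>v. A u \<bullet> v) u)"

text \<open>
  For an everywhere defined operator on a Hilbert space, symmetry is self-adjointness;
  boundedness is then a consequence (Hellinger--Toeplitz) and is not assumed.
\<close>
definition self_adjoint_operator :: "('a::real_inner \<Rightarrow> 'a) \<Rightarrow> bool"
  where "self_adjoint_operator B \<longleftrightarrow> linear B \<and> (\<forall>u v. B u \<bullet> v = u \<bullet> B v)"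

end

theory Submission
  imports Defs
begin

text \<open>
  Fixed points of \<open>A\<close> are the critical points of the even functional
  \<open>J u = \<parallel>u\<parallel>\<^sup>2 / 2 - (T u - T 0)\<close>, which is coercive and satisfies the Palais--Smale condition
  because \<open>A\<close> is compact and sublinear. The spectral condition makes \<open>J\<close> negative on the circle
  of radius \<open>r2\<close> in the span of \<open>e2\<close> and \<open>e3\<close>. A continuous odd map \<open>\<eta>\<close> that lowers \<open>J\<close> replaces the
  gradient flow: orbits of \<open>\<eta>\<close> starting in \<open>{J < 0}\<close> approach critical points of negative level.
  If \<open>p\<close> and \<open>-p\<close> were the only nonzero critical points, both would be asymptotically stable
  minimisers, and their basins of attraction would be disjoint open sets exchanged by
  \<open>u \<mapsto> -u\<close> that cover the circle, contradicting its connectedness.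
\<close>

text \<open>\<open>F\<close> is the gradient of \<open>J\<close>, in the Gateaux sense, so the mean
  value theorem is available on line segments. \<open>palais_smale\<close> is what the usual
  sequential condition yields on bounded closed sets without critical points.\<close>

locale even_palais_smale_functional =
  fixes J :: "'a::{real_inner,complete_space} \<Rightarrow> real" and F :: "'a \<Rightarrow> 'a" and L :: real
  assumes J_deriv: "((\<lambda>t. J (u + t *\<^sub>R v)) has_real_derivative F (u + t *\<^sub>R v) \<bullet> v) (at t)"
    and J_cont: "continuous_on UNIV J"
    and J_even: "J (- u) = J u"
    and J_0: "J 0 = 0"
    and F_cont: "continuous_on UNIV F"
    and F_odd: "F (- u) = - F u"
    and J_ge: "L \<le> J u"
    and bounded_negative: "bounded {u. J u < 0}"
    and palais_smale: "closed S \<Longrightarrow> bounded S \<Longrightarrow> (\<And>u. u \<in> S \<Longrightarrow> F u \<noteq> 0) \<Longrightarrow>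
      \<exists>e>0. \<forall>u\<in>S. e \<le> norm (F u)"
begin

section \<open>Odd descent maps and their orbits\<close>

lemma F_0: "F 0 = 0"
proof -
  have "F 0 + F 0 = 0" using F_odd[of 0] by (simp add: eq_neg_iff_add_eq_0)
  then have "2 *\<^sub>R F 0 = 0" by (simp only: scaleR_2)
  then show ?thesis by simp
qed

text \<open>A continuous \<open>F\<close> need not have a gradient flow, so one discrete step takes
  its place. The decrease condition is of Armijo type, with factor 1/2. The bound \<open>c\<close>
  prevents orbits from jumping across an annulus.\<close>

definition descent_map :: "real \<Rightarrow> ('a \<Rightarrow> 'a) \<Rightarrow> bool" where
  "descent_map c \<eta> \<longleftrightarrow> continuous_on UNIV \<eta> \<and>
    (\<forall>u. \<eta> (- u) = - \<eta> u \<and> norm (\<eta> u - u) \<le> c \<and>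
      norm (F u) * norm (\<eta> u - u) / 2 \<le> J u - J (\<eta> u) \<and> (\<eta> u = u \<longrightarrow> F u = 0))"

text \<open>By continuity of \<open>F\<close>, a short step from \<open>u\<close> against
  \<open>F u\<close> keeps the slope above half of its initial value \<open>norm (F u) ^ 2\<close>;
  the mean value theorem then gives the decrease.\<close>

lemma descent_map_exists:
  assumes "c > 0"
  shows "\<exists>\<eta>. descent_map c \<eta>"
proof -
  text \<open>The gradient step may be made as long as the pair (starting point, step length) stays off
    the closed set \<open>K\<close>, so the distance to \<open>K\<close> is a step length depending continuously
    on the point.\<close>
  define K where "K = {z. F (fst z - snd z *\<^sub>R F (fst z)) \<bullet> F (fst z) \<le> F (fst z) \<bullet> F (fst z) / 2}"
  define r where "r u = infdist (u, 0::real) K" for u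
  \<comment> \<open>Taking both \<open>r u\<close> and \<open>r (- u)\<close> makes \<open>s\<close>
    even and hence \<open>\<eta>\<close> odd; the last term bounds \<open>s u * norm (F u)\<close>
    by \<open>c\<close>.\<close>
  define s where "s u = min (min (r u) (r (- u))) (c / (1 + norm (F u)))" for u
  define \<eta> where "\<eta> u = u - s u *\<^sub>R F u" for u
  have F_comp: "continuous_on X (\<lambda>x. F (f x))" if "continuous_on X f"
    for X :: "'b::topological_space set" and f
    using continuous_on_compose2[OF F_cont that] by simp
  have "closed K"
    unfolding K_def by (intro closed_Collect_le continuous_intros F_comp) auto
  \<comment> \<open>The distance to an empty set is 0 by convention, so vanishing of
    \<open>infdist\<close> characterises membership only once \<open>K\<close> is known to be
    nonempty.\<close>
  have "(0, 0) \<in> K"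
    by (simp add: K_def F_0)
  then have "K \<noteq> {}" by auto
  have r_cont: "continuous_on UNIV r"
    unfolding r_def by (intro continuous_intros)
  have r_neg_cont: "continuous_on UNIV (\<lambda>u. r (- u))"
    by (rule continuous_on_compose2[OF r_cont]) (auto intro: continuous_intros)
  have pos: "1 + norm (F u) > 0" for u
    by (smt (verit) norm_ge_zero)
  then have nz: "1 + norm (F u) \<noteq> 0" for u
    by (metis less_irrefl)
  have s_cont: "continuous_on UNIV s"
    unfolding s_def
    by (intro continuous_on_min continuous_on_divide continuous_on_const continuous_on_add
        continuous_on_norm r_cont r_neg_cont F_cont) (simp add: nz)
  have s_even: "s (- u) = s u" for u
    by (simp add: s_def F_odd min.commute)
  have r_nonneg: "r u \<ge> 0" for u
    by (simp add: r_def infdist_nonneg)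
  have s_nonneg: "s u \<ge> 0" for u
    using r_nonneg[of u] r_nonneg[of "-u"] pos[of u] \<open>c > 0\<close> by (simp add: s_def)
  have r_pos: "r u > 0" if "F u \<noteq> 0" for u
  proof -
    have "(u, 0) \<notin> K"
      using that by (simp add: K_def not_le)
    then have "r u \<noteq> 0"
      using in_closed_iff_infdist_zero[OF \<open>closed K\<close> \<open>K \<noteq> {}\<close>] by (simp add: r_def)
    then show ?thesis using r_nonneg[of u] by simp
  qed
  have s_pos: "s u > 0" if "F u \<noteq> 0" for u
    using r_pos[of u] r_pos[of "- u"] that pos[of u] \<open>c > 0\<close> by (simp add: s_def F_odd)
  have descent: "s u * (norm (F u))\<^sup>2 / 2 \<le> J u - J (\<eta> u)" for u
  proof (cases "s u = 0")
    case True
    then show ?thesis by (simp add: \<eta>_def)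
  next
    case False
    then have "s u > 0" using s_nonneg[of u] by simp
    then obtain \<sigma> where \<sigma>: "0 < \<sigma>" "\<sigma> < s u"
      and eq: "J (u + s u *\<^sub>R (- F u)) - J (u + 0 *\<^sub>R (- F u))
                = (s u - 0) * (F (u + \<sigma> *\<^sub>R (- F u)) \<bullet> (- F u))"
      using MVT2[of 0 "s u" "\<lambda>t. J (u + t *\<^sub>R (- F u))" "\<lambda>t. F (u + t *\<^sub>R (- F u)) \<bullet> (- F u)"]
        J_deriv[of u "- F u"] by blast
    \<comment> \<open>This pair is nearer to \<open>(u, 0)\<close> than \<open>K\<close> is, because
      \<open>\<sigma> < s u \<le> r u\<close>.\<close>
    have "(u, \<sigma>) \<notin> K"
    proof
      assume "(u, \<sigma>) \<in> K"
      then have "r u \<le> dist (u, 0) (u, \<sigma>)"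
        unfolding r_def by (rule infdist_le)
      also have "\<dots> = \<sigma>" using \<sigma> by (simp add: dist_Pair_Pair)
      finally show False using \<sigma> by (simp add: s_def)
    qed
    then have "(norm (F u))\<^sup>2 / 2 \<le> F (u - \<sigma> *\<^sub>R F u) \<bullet> F u"
      by (simp add: K_def power2_norm_eq_inner)
    then have "s u * ((norm (F u))\<^sup>2 / 2) \<le> s u * (F (u - \<sigma> *\<^sub>R F u) \<bullet> F u)"
      by (rule mult_left_mono[OF _ s_nonneg])
    then show ?thesis using eq by (simp add: \<eta>_def)
  qed
  have norm_step: "norm (\<eta> u - u) = s u * norm (F u)" for u
    using s_nonneg[of u] by (simp add: \<eta>_def)
  have "descent_map c \<eta>"
    unfolding descent_map_def
  proof (intro conjI allI impI)
    show "continuous_on UNIV \<eta>"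
      unfolding \<eta>_def by (intro continuous_intros s_cont F_cont)
    fix u
    show "\<eta> (- u) = - \<eta> u" by (simp add: \<eta>_def s_even F_odd)
    have "s u * norm (F u) \<le> c / (1 + norm (F u)) * (1 + norm (F u))"
      using \<open>c > 0\<close> pos[of u] by (intro mult_mono) (auto simp: s_def)
    then show "norm (\<eta> u - u) \<le> c"
      using pos[of u] by (simp add: norm_step)
    show "norm (F u) * norm (\<eta> u - u) / 2 \<le> J u - J (\<eta> u)"
      using descent[of u] by (simp add: norm_step power2_eq_square mult_ac)
    show "F u = 0" if "\<eta> u = u"
    proof -
      have "s u = 0 \<or> F u = 0" using that by (simp add: \<eta>_def)
      then show ?thesis using s_pos[of u] by (metis less_irrefl)
    qed
  qed
  then show ?thesis by blast
qed

context
  fixes c \<eta> assumes \<eta>: "descent_map c \<eta>"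
begin

lemma descent_map_cont: "continuous_on UNIV \<eta>"
  and descent_map_odd: "\<eta> (- u) = - \<eta> u"
  and descent_map_step: "norm (\<eta> u - u) \<le> c"
  and descent_map_decrease: "norm (F u) * norm (\<eta> u - u) / 2 \<le> J u - J (\<eta> u)"
  and descent_map_fixed: "\<eta> u = u \<Longrightarrow> F u = 0"
  using \<eta> by (auto simp: descent_map_def)

lemma descent_map_le: "J (\<eta> u) \<le> J u"
  using descent_map_decrease[of u]
  by (smt (verit) divide_nonneg_nonneg mult_nonneg_nonneg norm_ge_zero)

lemma funpow_odd: "(\<eta> ^^ n) (- u) = - (\<eta> ^^ n) u"
  by (induction n) (auto simp: descent_map_odd)

lemma funpow_cont: "continuous_on UNIV (\<eta> ^^ n)"
proof (induction n)
  case 0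
  then show ?case by (simp add: id_def)
next
  case (Suc n)
  then show ?case
    using continuous_on_compose[of UNIV "\<eta> ^^ n" \<eta>] continuous_on_subset[OF descent_map_cont] by simp
qed

lemma funpow_le: "J ((\<eta> ^^ n) u) \<le> J u"
  by (induction n) (auto intro: order_trans[OF descent_map_le])

text \<open>An orbit avoiding \<open>U\<close> stays in a bounded closed set without critical
  points, where \<open>norm (F v)\<close> is at least some \<open>e > 0\<close>. Each step is then
  at most \<open>2 / e\<close> times the drop of \<open>J\<close>, so the orbit has finite length
  and converges; its limit is fixed by \<open>\<eta>\<close>, hence critical, a
  contradiction.\<close>

lemma orbit_enters:
  assumes "open U" and crit: "\<And>u. F u = 0 \<Longrightarrow> J u < 0 \<Longrightarrow> u \<in> U" and "J u < 0"
  shows "\<exists>n. (\<eta> ^^ n) u \<in> U"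
proof (rule ccontr)
  assume outside: "\<nexists>n. (\<eta> ^^ n) u \<in> U"
  define x where "x n = (\<eta> ^^ n) u" for n
  define Z where "Z = {v. J v \<le> J u} \<inter> - U"
  have "closed Z"
    unfolding Z_def using \<open>open U\<close>
    by (intro closed_Int closed_Collect_le closed_Compl J_cont continuous_intros)
  have "bounded Z"
    by (rule bounded_subset[OF bounded_negative]) (use \<open>J u < 0\<close> in \<open>auto simp: Z_def\<close>)
  have Z_noncrit: "F v \<noteq> 0" if "v \<in> Z" for v
    using that crit[of v] \<open>J u < 0\<close> by (auto simp: Z_def)
  obtain e where "e > 0" and e: "\<And>v. v \<in> Z \<Longrightarrow> e \<le> norm (F v)"
    using palais_smale[OF \<open>closed Z\<close> \<open>bounded Z\<close> Z_noncrit] by blast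
  have xZ: "x n \<in> Z" for n
    using outside funpow_le[of n u] by (auto simp: Z_def x_def)
  have xSuc: "x (Suc n) = \<eta> (x n)" for n
    by (simp add: x_def)
  have step_le: "norm (x (Suc n) - x n) \<le> 2 / e * (J (x n) - J (x (Suc n)))" for n
  proof -
    have "e * norm (x (Suc n) - x n) \<le> norm (F (x n)) * norm (x (Suc n) - x n)"
      by (intro mult_right_mono e xZ) simp
    also have "\<dots> \<le> 2 * (J (x n) - J (x (Suc n)))"
      using descent_map_decrease[of "x n"] by (simp add: xSuc)
    finally show ?thesis using \<open>e > 0\<close> by (simp add: field_simps)
  qed
  have "decseq (\<lambda>n. J (x n))"
    by (rule decseq_SucI) (simp add: xSuc descent_map_le)
  then obtain l where l: "(\<lambda>n. J (x n)) \<longlonglongrightarrow> l"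
    using decseq_convergent[of "\<lambda>n. J (x n)" L] J_ge by blast
  have dist_le: "norm (x n - x m) \<le> 2 / e * (J (x m) - J (x n))" if "m \<le> n" for m n
    using that
  proof (induction n rule: dec_induct)
    case (step n)
    have "norm (x (Suc n) - x m) \<le> norm (x (Suc n) - x n) + norm (x n - x m)"
      using norm_triangle_ineq[of "x (Suc n) - x n" "x n - x m"] by simp
    also have "\<dots> \<le> 2 / e * (J (x n) - J (x (Suc n))) + 2 / e * (J (x m) - J (x n))"
      by (intro add_mono step_le step.IH)
    finally show ?case by (simp add: algebra_simps)
  qed simp
  have "Cauchy (\<lambda>n. J (x n))"
    using l LIMSEQ_imp_Cauchy by blast
  have "Cauchy x"
  proof (rule CauchyI')
    fix \<epsilon> :: real assume "\<epsilon> > 0"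
    then obtain M where M: "\<And>m n. m \<ge> M \<Longrightarrow> n \<ge> M \<Longrightarrow> norm (J (x m) - J (x n)) < e / 2 * \<epsilon>"
      using CauchyD[OF \<open>Cauchy (\<lambda>n. J (x n))\<close>, of "e / 2 * \<epsilon>"] \<open>e > 0\<close> by auto
    have "dist (x m) (x n) < \<epsilon>" if "M \<le> m" "m < n" for m n
    proof -
      have "J (x m) - J (x n) < e / 2 * \<epsilon>"
        using M[of m n] that unfolding real_norm_def by linarith
      then have "2 / e * (J (x m) - J (x n)) < \<epsilon>"
        using \<open>e > 0\<close> by (simp add: field_simps)
      then show ?thesis
        using dist_le[of m n] that by (simp add: dist_norm norm_minus_commute)
    qed
    then show "\<exists>M. \<forall>m\<ge>M. \<forall>n>m. dist (x m) (x n) < \<epsilon>" by blast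
  qed
  then obtain s where lim: "x \<longlonglongrightarrow> s"
    using Cauchy_convergent convergent_def by blast
  have "(\<lambda>n. \<eta> (x n)) \<longlonglongrightarrow> \<eta> s"
    by (rule continuous_on_tendsto_compose[OF descent_map_cont lim]) auto
  then have "\<eta> s = s"
    using LIMSEQ_Suc[OF lim] by (auto simp: xSuc intro: LIMSEQ_unique)
  then have "F s = 0" by (rule descent_map_fixed)
  moreover have "s \<in> Z"
    using closed_sequentially[OF \<open>closed Z\<close> _ lim] xZ by blast
  ultimately show False using Z_noncrit by blast
qed

end

section \<open>Multiplicity from disjoint basins of attraction\<close>

theorem two_pairs_of_critical_points:
  assumes "connected S" and "S \<noteq> {}" and S_sym: "\<And>u. u \<in> S \<Longrightarrow> - u \<in> S"
    and S_neg: "\<And>u. u \<in> S \<Longrightarrow> J u < 0"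
  shows "\<exists>p q. p \<noteq> 0 \<and> q \<noteq> 0 \<and> p \<noteq> q \<and> p \<noteq> - q \<and> F p = 0 \<and> F q = 0"
proof (rule ccontr)
  assume contra: "\<not> ?thesis"
  obtain x0 where x0: "x0 \<in> S" using \<open>S \<noteq> {}\<close> by blast
  obtain p where p: "F p = 0" "J p < 0"
  proof -
    obtain \<eta> where "descent_map 1 \<eta>" using descent_map_exists[of 1] by auto
    \<comment> \<open>No orbit enters the empty set, so the hypothesis on critical points must fail
      for it: one of negative level exists.\<close>
    from orbit_enters[OF this, of "{}" x0] S_neg[OF x0] that show ?thesis by auto
  qed
  then have "p \<noteq> 0" using J_0 by auto
  have crit: "u = p \<or> u = - p" if "F u = 0" "J u < 0" for u
    using contra p(1) \<open>p \<noteq> 0\<close> that J_0 by (metis minus_minus order_less_irrefl)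
  \<comment> \<open>The points 0 and \<open>- p\<close> have distances \<open>2 * d\<close> and
    \<open>4 * d\<close> from \<open>p\<close>. So the annulus \<open>R\<close> contains no critical
    point, and the open balls of radius \<open>d\<close> about \<open>p\<close> and
    \<open>- p\<close> are disjoint.\<close>
  define d where "d = norm p / 2"
  have "d > 0" using \<open>p \<noteq> 0\<close> by (simp add: d_def)
  then obtain \<eta> where \<eta>: "descent_map (d/4) \<eta>" using descent_map_exists[of "d/4"] by auto
  define R where "R = {u. d/2 \<le> norm (u - p) \<and> norm (u - p) \<le> d}"
  have "closed R"
    unfolding R_def by (intro closed_Collect_conj closed_Collect_le continuous_intros)
  have "bounded R"
    by (rule bounded_subset[OF bounded_cball[of p d]]) (auto simp: R_def dist_norm norm_minus_commute)
  have R_noncrit: "F u \<noteq> 0" if "u \<in> R" for u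
  proof
    assume "F u = 0"
    have "u \<noteq> p" "u \<noteq> 0"
      using that \<open>d > 0\<close> by (auto simp: R_def d_def)
    moreover have "u \<noteq> - p"
    proof
      assume "u = - p"
      then have "u - p = - (2 *\<^sub>R p)" by (simp add: scaleR_2)
      then have "norm (u - p) = 4 * d" by (simp only: norm_minus_cancel norm_scaleR d_def)
      with that \<open>d > 0\<close> show False by (simp add: R_def)
    qed
    ultimately show False using contra p(1) \<open>p \<noteq> 0\<close> \<open>F u = 0\<close> by (metis minus_minus)
  qed
  obtain e where "e > 0" and e: "\<And>u. u \<in> R \<Longrightarrow> e \<le> norm (F u)"
    using palais_smale[OF \<open>closed R\<close> \<open>bounded R\<close> R_noncrit] by blast
  have J_min: "J p \<le> J u" for u
  proof (cases "J u < 0")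
    case True
    show ?thesis
    proof (rule ccontr)
      assume "\<not> J p \<le> J u"
      \<comment> \<open>Both critical points of negative level would lie in this open set, while the
        orbit of \<open>u\<close> never rises above the level \<open>J u\<close>.\<close>
      then have "\<exists>n. (\<eta> ^^ n) u \<in> {v. J u < J v}"
        using True by (intro orbit_enters[OF \<eta>] open_Collect_less J_cont continuous_intros)
          (auto dest!: crit simp: J_even)
      then show False using funpow_le[OF \<eta>] by (auto simp: not_less dest: leD)
    qed
  qed (use p in auto)
  text \<open>The ball of radius \<open>d/2\<close> is left in steps of length at most \<open>d/4\<close>; between
    the radii \<open>d/2\<close> and \<open>d\<close> every step pays at least \<open>e/2\<close> times its length in terms of \<open>J\<close>.
    Hence \<open>N\<close> is a forward invariant neighbourhood of \<open>p\<close>.\<close>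
  define N where "N = {u. J u < J p + e * d / 8} \<inter> {u. J u + e / 2 * norm (u - p) < J p + e / 2 * d}"
  have "open N"
    unfolding N_def by (intro open_Int open_Collect_less J_cont continuous_intros)
  have "p \<in> N" using \<open>e > 0\<close> \<open>d > 0\<close> by (simp add: N_def)
  have N_ball: "norm (u - p) < d" if "u \<in> N" for u
  proof -
    have "e / 2 * norm (u - p) < e / 2 * d" using that J_min[of u] by (auto simp: N_def)
    then show ?thesis using \<open>e > 0\<close> by simp
  qed
  have N_inv: "\<eta> u \<in> N" if "u \<in> N" for u
  proof -
    have tri: "norm (\<eta> u - p) \<le> norm (u - p) + norm (\<eta> u - u)"
      using norm_triangle_ineq[of "u - p" "\<eta> u - u"] by simp
    have le: "J (\<eta> u) \<le> J u" by (rule descent_map_le[OF \<eta>])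
    have "J (\<eta> u) + e / 2 * norm (\<eta> u - p) < J p + e / 2 * d"
    proof (cases "norm (u - p) < d / 2")
      \<comment> \<open>The new distance is at most \<open>d/2 + d/4\<close>; the remaining
        \<open>e / 2 * (d / 4)\<close> is exactly the level margin \<open>e * d / 8\<close> in
        \<open>N\<close>.\<close>
      case True
      then have "norm (\<eta> u - p) \<le> 3 / 4 * d"
        using tri descent_map_step[OF \<eta>, of u] by simp
      then have "e / 2 * norm (\<eta> u - p) \<le> e / 2 * (3 / 4 * d)"
        using \<open>e > 0\<close> by (intro mult_left_mono) auto
      then show ?thesis using that le by (simp add: N_def)
    next
      \<comment> \<open>In the annulus the drop of \<open>J\<close> pays for the growth of
        \<open>e / 2 * norm (u - p)\<close>, so their sum does not increase.\<close>
      case False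
      then have "u \<in> R" using N_ball[OF that] by (simp add: R_def)
      have "e * norm (\<eta> u - u) \<le> norm (F u) * norm (\<eta> u - u)"
        by (intro mult_right_mono e \<open>u \<in> R\<close>) simp
      moreover have "e / 2 * norm (\<eta> u - p) \<le> e / 2 * (norm (u - p) + norm (\<eta> u - u))"
        using \<open>e > 0\<close> tri by (intro mult_left_mono) auto
      ultimately show ?thesis
        using that descent_map_decrease[OF \<eta>, of u] by (simp add: N_def algebra_simps)
    qed
    then show ?thesis using that le by (simp add: N_def)
  qed
  have N_funpow: "(\<eta> ^^ n) u \<in> N" if "u \<in> N" for n u
    using that by (induction n) (auto intro: N_inv)
  have N_disjoint: "- u \<notin> N" if "u \<in> N" for u
  proof
    assume "- u \<in> N"
    have "2 *\<^sub>R p = - (u - p) - (- u - p)" by (simp add: scaleR_2)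
    then have "2 * norm p \<le> norm (u - p) + norm (- u - p)"
      using norm_triangle_ineq4[of "- (u - p)" "- u - p"]
      by (metis norm_minus_cancel norm_scaleR abs_numeral)
    then show False using N_ball[OF that] N_ball[OF \<open>- u \<in> N\<close>] norm_ge_zero[of p]
      by (simp add: d_def)
  qed
  \<comment> \<open>These are the basins of \<open>p\<close> and \<open>- p\<close>. Separating
    \<open>S\<close> by them would amount to a continuous odd map from \<open>S\<close> to {-1, 1},
    that is, to genus one.\<close>
  define W where "W = (\<Union>n. (\<eta> ^^ n) -` N)"
  define W' where "W' = (\<Union>n. (\<eta> ^^ n) -` (uminus -` N))"
  have "open (uminus -` N)"
    using \<open>open N\<close> by (intro open_vimage continuous_intros)
  have "open W" "open W'"
    unfolding W_def W'_def
    by (intro open_UN ballI open_vimage \<open>open N\<close> \<open>open (uminus -` N)\<close> funpow_cont[OF \<eta>])+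
  have W_sym: "- u \<in> W" if "u \<in> W'" for u
    using that by (auto simp: W_def W'_def funpow_odd[OF \<eta>])
  have W'_sym: "- u \<in> W'" if "u \<in> W" for u
    using that by (auto simp: W_def W'_def funpow_odd[OF \<eta>])
  have cover: "S \<subseteq> W \<union> W'"
  proof
    fix u assume "u \<in> S"
    then have "\<exists>n. (\<eta> ^^ n) u \<in> N \<union> uminus -` N"
      using \<open>open N\<close> \<open>open (uminus -` N)\<close> \<open>p \<in> N\<close> S_neg
      by (intro orbit_enters[OF \<eta>]) (auto dest!: crit)
    then show "u \<in> W \<union> W'" by (auto simp: W_def W'_def)
  qed
  have "W \<inter> W' \<inter> S = {}"
  proof -
    have False if "(\<eta> ^^ n) u \<in> N" "- (\<eta> ^^ k) u \<in> N" for n k u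
    proof -
      \<comment> \<open>Forward invariance of \<open>N\<close> moves both memberships to a common
        iterate.\<close>
      have "(\<eta> ^^ (k + n)) u \<in> N"
        using N_funpow[OF that(1), of k] by (simp add: funpow_add)
      moreover have "- (\<eta> ^^ (k + n)) u \<in> N"
        using N_funpow[OF that(2), of n] by (simp add: funpow_odd[OF \<eta>] funpow_add add.commute[of k n])
      ultimately show False using N_disjoint by blast
    qed
    then show ?thesis by (auto simp: W_def W'_def)
  qed
  moreover have "W \<inter> S \<noteq> {}" "W' \<inter> S \<noteq> {}"
    using x0 cover S_sym[OF x0] W_sym[of x0] W'_sym[of x0] by blast+
  ultimately show False
    using connectedD[OF \<open>connected S\<close> \<open>open W\<close> \<open>open W'\<close>] cover by blast
qed

end

section \<open>Growth and compactness of the operator\<close>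

lemma sublinear_bound:
  fixes A :: "'a::real_normed_vector \<Rightarrow> 'b::real_normed_vector"
  assumes "compact_operator A" and "\<theta> < 1"
    and "Limsup at_infinity (\<lambda>u. ereal (norm (A u) / norm u powr \<theta>)) < \<infinity>"
  shows "\<exists>K. \<forall>u. norm (A u) \<le> K + norm u / 4"
proof -
  obtain C where "Limsup at_infinity (\<lambda>u. ereal (norm (A u) / norm u powr \<theta>)) < ereal C"
    using ereal_dense2[OF assms(3)] by blast
  then have "\<forall>\<^sub>F u in at_infinity. ereal (norm (A u) / norm u powr \<theta>) < ereal C"
    by (rule Limsup_lessD)
  \<comment> \<open>Beyond this threshold \<open>C * norm u powr \<theta>\<close> is at most
    \<open>norm u / 4\<close>; the 1 keeps \<open>norm u\<close> positive.\<close>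
  moreover have "\<forall>\<^sub>F u::'a in at_infinity. max 1 ((4 * \<bar>C\<bar>) powr (1 / (1 - \<theta>))) \<le> norm u"
    unfolding eventually_at_infinity by blast
  ultimately have "\<forall>\<^sub>F u in at_infinity. norm (A u) \<le> norm u / 4"
  proof eventually_elim
    case (elim u)
    then have u: "norm u \<ge> 1" "(4 * \<bar>C\<bar>) powr (1 / (1 - \<theta>)) \<le> norm u" by auto
    have "4 * \<bar>C\<bar> = ((4 * \<bar>C\<bar>) powr (1 / (1 - \<theta>))) powr (1 - \<theta>)"
      using \<open>\<theta> < 1\<close> by (simp add: powr_powr)
    also have "\<dots> \<le> norm u powr (1 - \<theta>)"
      using u \<open>\<theta> < 1\<close> by (intro powr_mono2) auto
    finally have C: "4 * C \<le> norm u powr (1 - \<theta>)" by simp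
    have "norm (A u) < C * norm u powr \<theta>"
    proof -
      have "norm u powr \<theta> > 0" using u(1) powr_gt_zero[of "norm u" \<theta>] by linarith
      then show ?thesis using elim(1) by (simp add: pos_divide_less_eq)
    qed
    also have "\<dots> \<le> norm u powr (1 - \<theta>) / 4 * norm u powr \<theta>"
      using C by (intro mult_right_mono) auto
    also have "\<dots> = norm u / 4"
      using u by (simp flip: powr_add)
    finally show ?case by simp
  qed
  then obtain b where b: "\<And>u. b \<le> norm u \<Longrightarrow> norm (A u) \<le> norm u / 4"
    by (auto simp: eventually_at_infinity)
  have "bounded (A ` cball 0 b)"
    using assms(1) bounded_subset[OF compact_imp_bounded closure_subset]
    by (auto simp: compact_operator_def)
  then obtain K where K: "K > 0" "\<And>u. norm u \<le> b \<Longrightarrow> norm (A u) \<le> K"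
    by (auto simp: bounded_pos)
  have "norm (A u) \<le> K + norm u / 4" for u
  proof (cases "b \<le> norm u")
    case True
    then show ?thesis using b[of u] K(1) by linarith
  next
    case False
    then have "norm (A u) \<le> K" by (intro K(2)) simp
    then show ?thesis using norm_ge_zero[of u] by linarith
  qed
  then show ?thesis by blast
qed

text \<open>If \<open>x n - A (x n)\<close> tends to 0, a convergent subsequence of
  \<open>A (x n)\<close> forces \<open>x n\<close> to converge along it to the same limit, a fixed
  point in \<open>S\<close>.\<close>

lemma compact_perturbation_palais_smale:
  fixes A :: "'a::real_normed_vector \<Rightarrow> 'a"
  assumes A: "compact_operator A" and "closed S" "bounded S" and "\<And>u. u \<in> S \<Longrightarrow> A u \<noteq> u"
  shows "\<exists>e>0. \<forall>u\<in>S. e \<le> norm (u - A u)"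
proof (rule ccontr)
  assume "\<not> ?thesis"
  then have "\<exists>u\<in>S. norm (u - A u) < 1 / real (Suc n)" for n
    by (metis not_le of_nat_0_less_iff zero_less_Suc zero_less_divide_1_iff)
  then obtain x where x: "\<And>n. x n \<in> S" "\<And>n. norm (x n - A (x n)) < 1 / real (Suc n)"
    by metis
  have "seq_compact (closure (A ` S))"
    using A \<open>bounded S\<close> by (simp add: compact_operator_def compact_eq_seq_compact_metric)
  moreover have "A (x n) \<in> closure (A ` S)" for n
    using x(1) closure_subset by blast
  ultimately obtain l r where r: "strict_mono (r :: nat \<Rightarrow> nat)" and "((\<lambda>n. A (x n)) \<circ> r) \<longlonglongrightarrow> l"
    using seq_compactE[of "closure (A ` S)" "\<lambda>n. A (x n)"] by metis
  then have l: "(\<lambda>n. A (x (r n))) \<longlonglongrightarrow> l" by (simp add: o_def)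
  have "(\<lambda>n. x n - A (x n)) \<longlonglongrightarrow> 0"
    by (rule Lim_null_comparison[OF _ LIMSEQ_inverse_real_of_nat])
      (use x(2) in \<open>auto intro!: always_eventually less_imp_le simp: inverse_eq_divide\<close>)
  then have "(\<lambda>n. (x (r n) - A (x (r n))) + A (x (r n))) \<longlonglongrightarrow> 0 + l"
    using LIMSEQ_subseq_LIMSEQ[OF _ r] l by (intro tendsto_add) (auto simp: o_def)
  then have lim: "(\<lambda>n. x (r n)) \<longlonglongrightarrow> l" by simp
  have "l \<in> S"
    using closed_sequentially[OF \<open>closed S\<close> _ lim] x(1) by blast
  have "(\<lambda>n. A (x (r n))) \<longlonglongrightarrow> A l"
    using A by (intro continuous_on_tendsto_compose[OF _ lim, of UNIV]) (auto simp: compact_operator_def)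
  then have "A l = l" using l LIMSEQ_unique by blast
  with assms(4) \<open>l \<in> S\<close> show False by blast
qed

section \<open>Evenness and continuity of the potential\<close>

lemma gateaux_derivative_line:
  assumes "\<And>u. has_gateaux_derivative T (\<lambda>v. A u \<bullet> v) u"
  shows "((\<lambda>t. T (u + t *\<^sub>R v)) has_real_derivative A (u + t *\<^sub>R v) \<bullet> v) (at t)"
proof -
  have "((\<lambda>h. T ((u + t *\<^sub>R v) + h *\<^sub>R v)) has_real_derivative A (u + t *\<^sub>R v) \<bullet> v) (at 0)"
    using assms by (simp add: has_gateaux_derivative_def)
  then have "((\<lambda>h. T (u + (h + t) *\<^sub>R v)) has_real_derivative A (u + t *\<^sub>R v) \<bullet> v) (at 0)"
    by (simp add: algebra_simps)
  then show ?thesis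
    using DERIV_shift[of "\<lambda>t. T (u + t *\<^sub>R v)" _ 0 t] by simp
qed

text \<open>Oddness of \<open>A\<close> makes the derivative of \<open>T (t u) - T (- t u)\<close>
  in \<open>t\<close> vanish, and the difference is 0 at \<open>t = 0\<close>.\<close>

lemma potential_even:
  fixes A :: "'a::real_inner \<Rightarrow> 'a"
  assumes T: "\<And>u. has_gateaux_derivative T (\<lambda>v. A u \<bullet> v) u" and "odd_operator A"
  shows "T (- u) = T u"
proof -
  have "((\<lambda>t. T (0 + t *\<^sub>R u) - T (0 + t *\<^sub>R (- u))) has_real_derivative 0) (at t)" for t
  proof -
    have "((\<lambda>t. T (0 + t *\<^sub>R u) - T (0 + t *\<^sub>R (- u))) has_real_derivative
        A (0 + t *\<^sub>R u) \<bullet> u - A (0 + t *\<^sub>R (- u)) \<bullet> (- u)) (at t)"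
      by (intro DERIV_diff gateaux_derivative_line[of T A, OF T])
    then show ?thesis using \<open>odd_operator A\<close> by (simp add: odd_operator_def)
  qed
  from DERIV_isconst_all[of "\<lambda>t. T (0 + t *\<^sub>R u) - T (0 + t *\<^sub>R (- u))" 1 0] this
  show ?thesis by simp
qed

text \<open>The mean value theorem on the segment, where convexity bounds the norm by that of an
  endpoint. It yields continuity of \<open>T\<close>, which Gateaux differentiability alone does not
  give, and coercivity of \<open>J\<close>.\<close>

lemma potential_locally_lipschitz:
  fixes A :: "'a::real_inner \<Rightarrow> 'a"
  assumes T: "\<And>u. has_gateaux_derivative T (\<lambda>v. A u \<bullet> v) u"
    and K: "\<And>u. norm (A u) \<le> K + norm u / 4"
  shows "\<bar>T v - T u\<bar> \<le> (K + max (norm u) (norm v) / 4) * norm (v - u)"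
proof -
  obtain t where t: "0 < t" "t < 1"
    and eq: "T (u + 1 *\<^sub>R (v - u)) - T (u + 0 *\<^sub>R (v - u)) = (1 - 0) * (A (u + t *\<^sub>R (v - u)) \<bullet> (v - u))"
    using MVT2[of 0 1 "\<lambda>t. T (u + t *\<^sub>R (v - u))" "\<lambda>t. A (u + t *\<^sub>R (v - u)) \<bullet> (v - u)"]
      gateaux_derivative_line[of T A, OF T] by auto
  have "norm (u + t *\<^sub>R (v - u)) = norm ((1 - t) *\<^sub>R u + t *\<^sub>R v)"
    by (simp add: algebra_simps)
  also have "\<dots> \<le> (1 - t) * norm u + t * norm v"
    using t norm_triangle_ineq[of "(1 - t) *\<^sub>R u" "t *\<^sub>R v"] by simp
  also have "\<dots> \<le> max (norm u) (norm v)"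
    using t by (intro convex_bound_le) auto
  finally have "norm (A (u + t *\<^sub>R (v - u))) \<le> K + max (norm u) (norm v) / 4"
    using K[of "u + t *\<^sub>R (v - u)"] by linarith
  then have "norm (A (u + t *\<^sub>R (v - u))) * norm (v - u) \<le> (K + max (norm u) (norm v) / 4) * norm (v - u)"
    by (intro mult_right_mono) auto
  then show ?thesis
    using eq Cauchy_Schwarz_ineq2[of "A (u + t *\<^sub>R (v - u))" "v - u"] by simp
qed

lemma potential_continuous:
  fixes A :: "'a::real_inner \<Rightarrow> 'a"
  assumes T: "\<And>u. has_gateaux_derivative T (\<lambda>v. A u \<bullet> v) u"
    and K: "\<And>u. norm (A u) \<le> K + norm u / 4"
  shows "continuous_on UNIV T"
  unfolding continuous_on_def
proof (intro ballI)
  fix u :: 'a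
  have "((\<lambda>v. (K + max (norm u) (norm v) / 4) * norm (v - u))
      \<longlongrightarrow> (K + max (norm u) (norm u) / 4) * norm (u - u)) (at u)"
    by (intro tendsto_intros) auto
  then have "((\<lambda>v. (K + max (norm u) (norm v) / 4) * norm (v - u)) \<longlongrightarrow> 0) (at u)" by simp
  then have "((\<lambda>v. T v - T u) \<longlongrightarrow> 0) (at u)"
  proof (rule Lim_null_comparison[rotated])
    show "\<forall>\<^sub>F v in at u. norm (T v - T u) \<le> (K + max (norm u) (norm v) / 4) * norm (v - u)"
      unfolding real_norm_def by (intro always_eventually allI potential_locally_lipschitz[OF T K])
  qed
  then show "(T \<longlongrightarrow> T u) (at u)" by (simp add: LIM_zero_iff)
qed

text \<open>Sylvester's criterion in dimension two, by completing the square; it is meant for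
  \<open>B2\<close> minus the identity on the span of \<open>e2\<close> and
  \<open>e3\<close>.\<close>

lemma quadratic_form_pos:
  fixes a b c x y :: real
  assumes "a > 0" and "b\<^sup>2 < a * c" and "x \<noteq> 0 \<or> y \<noteq> 0"
  shows "a * x\<^sup>2 + 2 * b * x * y + c * y\<^sup>2 > 0"
proof -
  have "a * (a * x\<^sup>2 + 2 * b * x * y + c * y\<^sup>2) = (a * x + b * y)\<^sup>2 + (a * c - b\<^sup>2) * y\<^sup>2"
    by (simp add: power2_eq_square algebra_simps)
  moreover have "(a * x + b * y)\<^sup>2 + (a * c - b\<^sup>2) * y\<^sup>2 > 0"
  proof (cases "y = 0")
    case False
    then have "(a * c - b\<^sup>2) * y\<^sup>2 > 0" using assms(2) by simp
    then show ?thesis by (simp add: add_nonneg_pos)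
  qed (use assms in auto)
  ultimately show ?thesis using \<open>a > 0\<close> by (metis zero_less_mult_pos)
qed

section \<open>Application to the given operator\<close>

theorem theorem1p2:
  fixes A B2 :: "'a::{real_inner,complete_space} \<Rightarrow> 'a"
    and e2 e3 :: 'a and \<theta> r2 :: real
  assumes "odd_operator A" and "compact_operator A" and "potential_operator A"
    and "0 \<le> \<theta>" and "\<theta> < 1"
    and "Limsup at_infinity (\<lambda>u. ereal (norm (A u) / norm u powr \<theta>)) < \<infinity>"
    and "self_adjoint_operator B2"
    and "norm e2 = 1" and "norm e3 = 1" and "e2 \<bullet> e3 = 0"
    and "B2 e2 \<bullet> e2 > 1" and "B2 e3 \<bullet> e3 > 1"
    and "(B2 e2 \<bullet> e3)\<^sup>2 - (1 - B2 e2 \<bullet> e2) * (1 - B2 e3 \<bullet> e3) < 0"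
    and "r2 > 0"
    and "\<And>s u. 0 < s \<Longrightarrow> s < 1 \<Longrightarrow> u \<in> span {e2, e3} \<Longrightarrow> norm u = r2 \<Longrightarrow>
           A (s *\<^sub>R u) \<bullet> u \<ge> B2 (s *\<^sub>R u) \<bullet> u"
  shows "\<exists>u1 u2. u1 \<noteq> 0 \<and> u2 \<noteq> 0 \<and> u1 \<noteq> u2 \<and> u1 \<noteq> - u2 \<and>
           A u1 = u1 \<and> A (- u1) = - u1 \<and> A u2 = u2 \<and> A (- u2) = - u2"
proof -
  have A_odd: "A (- u) = - A u" for u
    using assms(1) by (simp add: odd_operator_def)
  obtain T where T: "\<And>u. has_gateaux_derivative T (\<lambda>v. A u \<bullet> v) u"
    using assms(3) by (auto simp: potential_operator_def)
  obtain K where K: "\<And>u. norm (A u) \<le> K + norm u / 4"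
    using sublinear_bound[OF assms(2,5,6)] by blast
  define J where "J u = (u \<bullet> u) / 2 - (T u - T 0)" for u
  define F where "F u = u - A u" for u
  have J_lower: "(norm u)\<^sup>2 / 4 - K * norm u \<le> J u" for u
    using potential_locally_lipschitz[OF T K, of u 0]
    by (auto simp: J_def power2_eq_square algebra_simps dot_square_norm abs_le_iff)
  \<comment> \<open>The polynomial \<open>t^2 / 4 - K * t\<close> from \<open>J_lower\<close> has
    minimum \<open>- (K^2)\<close> and roots 0 and \<open>4 * K\<close>: the former bounds
    \<open>J\<close> below, the latter bounds the set where \<open>J\<close> is negative.\<close>
  interpret even_palais_smale_functional J F "- (K\<^sup>2)"
  proof
    fix u v :: 'a and t :: real
    have "((\<lambda>t. (u + t *\<^sub>R v) \<bullet> (u + t *\<^sub>R v) / 2) has_real_derivative (u + t *\<^sub>R v) \<bullet> v) (at t)"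
      by (auto intro!: derivative_eq_intros simp: algebra_simps inner_commute)
    then have "((\<lambda>t. J (u + t *\<^sub>R v)) has_real_derivative
        (u + t *\<^sub>R v) \<bullet> v - (A (u + t *\<^sub>R v) \<bullet> v - 0)) (at t)"
      unfolding J_def by (intro DERIV_diff gateaux_derivative_line[of T A, OF T] DERIV_const)
    then show "((\<lambda>t. J (u + t *\<^sub>R v)) has_real_derivative F (u + t *\<^sub>R v) \<bullet> v) (at t)"
      by (simp add: F_def inner_diff_left)
  next
    show "continuous_on UNIV J"
      unfolding J_def by (intro continuous_intros potential_continuous[OF T K]) auto
    show "continuous_on UNIV F"
      using assms(2) unfolding F_def compact_operator_def by (intro continuous_intros) auto
    show "J 0 = 0" by (simp add: J_def)
    fix u
    show "J (- u) = J u" by (simp add: J_def potential_even[OF T assms(1)])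
    show "F (- u) = - F u" by (simp add: F_def A_odd)
    have "0 \<le> (norm u / 2 - K)\<^sup>2" by simp
    then show "- (K\<^sup>2) \<le> J u" using J_lower[of u] by (simp add: power2_eq_square algebra_simps)
  next
    have "norm u \<le> 4 * K" if "J u < 0" for u
    proof (rule ccontr)
      assume "\<not> norm u \<le> 4 * K"
      then have "K * norm u \<le> norm u / 4 * norm u" by (intro mult_right_mono) auto
      then show False using J_lower[of u] that by (simp add: power2_eq_square)
    qed
    then show "bounded {u. J u < 0}" by (auto simp: bounded_iff)
  next
    fix S assume "closed S" "bounded S" "\<And>u. u \<in> S \<Longrightarrow> F u \<noteq> 0"
    then show "\<exists>e>0. \<forall>u\<in>S. e \<le> norm (F u)"
      using compact_perturbation_palais_smale[OF assms(2)] unfolding F_def by (metis right_minus_eq)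
  qed
  define \<gamma> where "\<gamma> x = r2 *\<^sub>R (cos x *\<^sub>R e2 + sin x *\<^sub>R e3)" for x
  have "linear B2" and B2_sym: "B2 u \<bullet> v = u \<bullet> B2 v" for u v
    using assms(7) by (auto simp: self_adjoint_operator_def)
  have "e2 \<bullet> e2 = 1" "e3 \<bullet> e3 = 1" using assms(8,9) by (auto simp: norm_eq_1)
  have J_neg: "J (\<gamma> x) < 0" for x
  proof -
    obtain c s where cs: "c\<^sup>2 + s\<^sup>2 = 1" and \<gamma>x: "\<gamma> x = r2 *\<^sub>R (c *\<^sub>R e2 + s *\<^sub>R e3)"
      using that[of "cos x" "sin x"] by (simp add: \<gamma>_def)
    define u where "u = r2 *\<^sub>R (c *\<^sub>R e2 + s *\<^sub>R e3)"
    have u_sq: "u \<bullet> u = r2\<^sup>2 * (c\<^sup>2 + s\<^sup>2)"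
      using \<open>e2 \<bullet> e2 = 1\<close> \<open>e3 \<bullet> e3 = 1\<close> assms(10)
      by (simp add: u_def inner_add_left inner_add_right inner_commute[of e3 e2] power2_eq_square algebra_simps)
    have u_span: "u \<in> span {e2, e3}"
      unfolding u_def by (intro span_scale span_add) (auto intro: span_base)
    have u_norm: "norm u = r2"
      using u_sq cs \<open>r2 > 0\<close> by (simp add: norm_eq_sqrt_inner)
    have B2u: "B2 u \<bullet> u > u \<bullet> u"
    proof -
      \<comment> \<open>The form of \<open>B2\<close> minus the identity at
        \<open>c e2 + s e3\<close>; symmetry of \<open>B2\<close> merges the mixed terms, and the
        determinant hypothesis makes it positive.\<close>
      let ?Q = "(B2 e2 \<bullet> e2 - 1) * c\<^sup>2 + 2 * (B2 e2 \<bullet> e3) * c * s + (B2 e3 \<bullet> e3 - 1) * s\<^sup>2"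
      have "c \<noteq> 0 \<or> s \<noteq> 0" using cs by auto
      then have "?Q > 0"
        using assms(11,13) by (intro quadratic_form_pos) (auto simp: algebra_simps)
      have "B2 e3 \<bullet> e2 = B2 e2 \<bullet> e3" by (metis B2_sym inner_commute)
      then have "B2 u \<bullet> u - u \<bullet> u = r2\<^sup>2 * ?Q"
        unfolding u_sq using \<open>e2 \<bullet> e2 = 1\<close> \<open>e3 \<bullet> e3 = 1\<close> assms(10)
        by (simp add: u_def linear_add[OF \<open>linear B2\<close>] linear_scale[OF \<open>linear B2\<close>]
            inner_add_left inner_add_right inner_commute[of e3 e2] power2_eq_square algebra_simps)
      moreover have "r2\<^sup>2 * ?Q > 0" using \<open>?Q > 0\<close> \<open>r2 > 0\<close> by simp
      ultimately show ?thesis by linarith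
    qed
    \<comment> \<open>On the segment from 0 to \<open>u\<close> the mean value parameter lies
      strictly between 0 and 1, just where \<open>A\<close> is compared with
      \<open>B2\<close>.\<close>
    obtain t where t: "0 < t" "t < 1"
      and eq: "J (0 + 1 *\<^sub>R u) - J (0 + 0 *\<^sub>R u) = (1 - 0) * (F (0 + t *\<^sub>R u) \<bullet> u)"
      using MVT2[of 0 1 "\<lambda>t. J (0 + t *\<^sub>R u)" "\<lambda>t. F (0 + t *\<^sub>R u) \<bullet> u"] J_deriv[of 0 u] by auto
    have "t * (B2 u \<bullet> u) \<le> A (t *\<^sub>R u) \<bullet> u"
      using assms(15)[OF t u_span u_norm] by (simp add: linear_scale[OF \<open>linear B2\<close>])
    moreover have "t * (u \<bullet> u) < t * (B2 u \<bullet> u)" using t B2u by simp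
    ultimately have "F (t *\<^sub>R u) \<bullet> u < 0" by (simp add: F_def inner_diff_left)
    then show ?thesis using eq by (simp add: J_0 u_def \<gamma>x)
  qed
  have "connected (range \<gamma>)"
    unfolding \<gamma>_def by (intro connected_continuous_image continuous_intros connected_UNIV)
  \<comment> \<open>The antipode on the circle is the shift of the angle by
    \<open>pi\<close>.\<close>
  moreover have "- \<gamma> x = \<gamma> (x + pi)" for x
    by (simp add: \<gamma>_def algebra_simps)
  then have "- u \<in> range \<gamma>" if "u \<in> range \<gamma>" for u
    using that by auto
  moreover have "J u < 0" if "u \<in> range \<gamma>" for u
    using that J_neg by auto
  ultimately obtain p q where "p \<noteq> 0" "q \<noteq> 0" "p \<noteq> q" "p \<noteq> - q" "F p = 0" "F q = 0"
    using two_pairs_of_critical_points[of "range \<gamma>"] by blast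
  then show ?thesis
    by (intro exI[of _ p] exI[of _ q]) (simp add: F_def A_odd)
qed

end
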